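(* Let $L:\mathbb{R}^d\times\mathbb{R}^p\to\mathbb{R}$ satisfy the regularity assumption (R) and the Polyak-\L{}ojasiewicz assumption (PL) of the context, and let $K\ge 1$ and $(x^k,y^k)_{0\le k\le K}$ be iterates of GRAND with stepsizes $\alpha,\beta>0$ and directions $s^k,t^k$ satisfying the direction assumption (D) of the context, where $\gamma_s\le\Gamma_s$ and $\gamma_t\le\Gamma_t$. Suppose $$\alpha\le\frac{2\gamma_s}{\Gamma_s^2\big[3\ell_{xx}+c_1\ell_{yx}^2/(\ell_\psi\Gamma_t^2)\big]},\qquad \beta\le\min\Big\{\frac{c_1}{3\ell_\psi\Gamma_t^2},\ \frac{\alpha\gamma_s m_x^2c_1}{3\ell_{yx}^2\iota(3c_2+2c_1)}\Big\},\qquad \beta<\frac{3\iota+c_1}{2\iota p_\psi c_1},$$ where the second term in the minimum is omitted if $\ell_{yx}=0$. Let $$\delta=\min\Big\{\frac{2\beta\iota p_\psi c_1}{3\iota+c_1},\ \frac{2\alpha\gamma_sm_x}{3}\Big\}.$$ Then $0<\delta<1$ and, for all $k=0,1,\dots,K-1$, $$\Delta^{k+1}\le(1-\delta)\Delta^k.$$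
   Context: Norms are Euclidean. (R) $L$ is twice differentiable in $(x,y)$ and $\nabla_xL$ is continuously differentiable in $(x,y)$; for every $y$, $L(\cdot,y)$ is $m_x$-strongly convex with $m_x>0$; $\nabla_xL$ is $\ell_{xx}$-Lipschitz in $x$ and $\ell_{xy}$-Lipschitz in $y$; $\nabla_yL$ is $\ell_{yx}$-Lipschitz in $x$ and $\ell_{yy}$-Lipschitz in $y$; here $\ell_{xx}>m_x>0$ and $\ell_{xy},\ell_{yx},\ell_{yy}\ge0$. Define $x^*(y)=\arg\min_xL(x,y)$ and $\psi(y)=\min_xL(x,y)=L(x^*(y),y)$. (PL) $\psi$ has a global maximizer $y^\star$, and there is $p_\psi>0$ such that $\frac12\|\nabla\psi(y)\|^2\ge p_\psi(\psi(y^\star)-\psi(y))$ for all $y\in\mathbb{R}^p$. GRAND: from $x^0\in\mathbb{R}^d$, $y^0\in\mathbb{R}^p$, for $k=0,\dots,K-1$ set $x^{k+1}=x^k-\alpha s^k$, $y^{k+1}=y^k+\beta t^k$. (D) There are positive constants $\gamma_s,\gamma_t,\Gamma_s,\Gamma_t$ such that for every $k$: $\|s^k\|\ge\sqrt{\gamma_s\Gamma_s}\,\|\nabla_xL(x^k,y^k)\|$, $(s^k)^\top\nabla_xL(x^k,y^k)\ge\|s^k\|^2/\Gamma_s$, $\|t^k\|\ge\sqrt{\gamma_t\Gamma_t}\,\|\nabla_yL(x^k,y^k)\|$, $(t^k)^\top\nabla_yL(x^k,y^k)\ge\|t^k\|^2/\Gamma_t$. Constants: if $\gamma_t<\Gamma_t$,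 let $\nu=(1-\gamma_t^2/\Gamma_t^2)^{-1/3}-1>0$, $c_1=\frac{\Gamma_t^2}{2\gamma_t}\cdot\frac{\nu}{1+\nu}$, $c_2=\frac{\Gamma_t^2}{2\gamma_t}\cdot\frac1\nu\big(\frac1{1+\nu}+1+\nu\big)$; if $\gamma_t=\Gamma_t$, let $c_1=c_2=\frac{\Gamma_t^2}{2\gamma_t}$. Further $\ell_\psi=\ell_{yy}+\ell_{yx}\ell_{xy}/m_x$, assumed positive, and $\iota=2\Gamma_t+\Gamma_t^2+c_1\ell_{yy}/(3\ell_\psi)$. Performance measures: $\Delta_y^k=\psi(y^\star)-\psi(y^k)$, $\Delta_x^k=L(x^k,y^k)-L(x^*(y^k),y^k)$, $\Delta^k=\big(\frac{3\iota}{c_1}+1\big)\Delta_y^k+\Delta_x^k$. *)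

theory Defs
  imports "HOL-Analysis.Analysis"
begin

definition grad :: "('a::real_inner \<Rightarrow> real) \<Rightarrow> 'a \<Rightarrow> 'a" where
  "grad f x = (THE D. GDERIV f x :> D)"

definition grad_x :: "('a::real_inner \<times> 'b::real_inner \<Rightarrow> real) \<Rightarrow> 'a \<Rightarrow> 'b \<Rightarrow> 'a" where
  "grad_x L x y = grad (\<lambda>u. L (u, y)) x"

definition grad_y :: "('a::real_inner \<times> 'b::real_inner \<Rightarrow> real) \<Rightarrow> 'a \<Rightarrow> 'b \<Rightarrow> 'b" where
  "grad_y L x y = grad (\<lambda>v. L (x, v)) y"

text \<open>On a product type the inner product is the sum of those of the factors, so \<open>grad L\<close> below
  is the full gradient in \<open>(x, y)\<close>.\<close>

definition twice_differentiable :: "('a::real_inner \<Rightarrow> real) \<Rightarrow> bool" where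
  "twice_differentiable f \<longleftrightarrow>
     (\<forall>z. f differentiable (at z)) \<and> (\<forall>z. grad f differentiable (at z))"

definition cont_differentiable :: "('a::real_normed_vector \<Rightarrow> 'b::real_normed_vector) \<Rightarrow> bool" where
  "cont_differentiable f \<longleftrightarrow>
     (\<exists>f' :: 'a \<Rightarrow> 'a \<Rightarrow>\<^sub>L 'b.
        (\<forall>z. (f has_derivative blinfun_apply (f' z)) (at z)) \<and> continuous_on UNIV f')"

definition strongly_convex :: "real \<Rightarrow> ('a::real_inner \<Rightarrow> real) \<Rightarrow> bool" where
  "strongly_convex m f \<longleftrightarrow>
     (\<forall>u v. \<forall>\<theta>\<in>{0..1}. f (\<theta> *\<^sub>R u + (1 - \<theta>) *\<^sub>R v)
        \<le> \<theta> * f u + (1 - \<theta>) * f v - m / 2 * \<theta> * (1 - \<theta>) * (norm (u - v))\<^sup>2)"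

definition regular ::
  "('a::real_inner \<times> 'b::real_inner \<Rightarrow> real) \<Rightarrow> real \<Rightarrow> real \<Rightarrow> real \<Rightarrow> real \<Rightarrow> real \<Rightarrow> bool" where
  "regular L m\<^sub>x l\<^sub>x\<^sub>x l\<^sub>x\<^sub>y l\<^sub>y\<^sub>x l\<^sub>y\<^sub>y \<longleftrightarrow>
     twice_differentiable L \<and>
     cont_differentiable (\<lambda>(x, y). grad_x L x y) \<and>
     0 < m\<^sub>x \<and> m\<^sub>x < l\<^sub>x\<^sub>x \<and> 0 \<le> l\<^sub>x\<^sub>y \<and> 0 \<le> l\<^sub>y\<^sub>x \<and> 0 \<le> l\<^sub>y\<^sub>y \<and>
     (\<forall>y. strongly_convex m\<^sub>x (\<lambda>x. L (x, y))) \<and>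
     (\<forall>y. l\<^sub>x\<^sub>x-lipschitz_on UNIV (\<lambda>x. grad_x L x y)) \<and>
     (\<forall>x. l\<^sub>x\<^sub>y-lipschitz_on UNIV (\<lambda>y. grad_x L x y)) \<and>
     (\<forall>y. l\<^sub>y\<^sub>x-lipschitz_on UNIV (\<lambda>x. grad_y L x y)) \<and>
     (\<forall>x. l\<^sub>y\<^sub>y-lipschitz_on UNIV (\<lambda>y. grad_y L x y))"

definition xstar :: "('a \<times> 'b \<Rightarrow> real) \<Rightarrow> 'b \<Rightarrow> 'a" where
  "xstar L y = (ARG_MIN (\<lambda>x. L (x, y)) x. True)"

definition psi :: "('a \<times> 'b \<Rightarrow> real) \<Rightarrow> 'b \<Rightarrow> real" where
  "psi L y = L (xstar L y, y)"

definition PL_cond :: "('a \<times> 'b::real_inner \<Rightarrow> real) \<Rightarrow> real \<Rightarrow> 'b \<Rightarrow> bool" where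
  "PL_cond L p\<^sub>\<psi> ystar \<longleftrightarrow>
     (\<forall>y. psi L y \<le> psi L ystar) \<and> 0 < p\<^sub>\<psi> \<and>
     (\<forall>y. 1 / 2 * (norm (grad (psi L) y))\<^sup>2 \<ge> p\<^sub>\<psi> * (psi L ystar - psi L y))"

definition GRAND_iterates ::
  "real \<Rightarrow> real \<Rightarrow> nat \<Rightarrow> (nat \<Rightarrow> 'a::real_vector) \<Rightarrow> (nat \<Rightarrow> 'b::real_vector)
    \<Rightarrow> (nat \<Rightarrow> 'a) \<Rightarrow> (nat \<Rightarrow> 'b) \<Rightarrow> bool" where
  "GRAND_iterates \<alpha> \<beta> K x y s t \<longleftrightarrow>
     (\<forall>k<K. x (Suc k) = x k - \<alpha> *\<^sub>R s k \<and> y (Suc k) = y k + \<beta> *\<^sub>R t k)"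

definition direction_cond ::
  "('a::real_inner \<times> 'b::real_inner \<Rightarrow> real) \<Rightarrow> real \<Rightarrow> real \<Rightarrow> real \<Rightarrow> real \<Rightarrow> nat
    \<Rightarrow> (nat \<Rightarrow> 'a) \<Rightarrow> (nat \<Rightarrow> 'b) \<Rightarrow> (nat \<Rightarrow> 'a) \<Rightarrow> (nat \<Rightarrow> 'b) \<Rightarrow> bool" where
  "direction_cond L \<gamma>\<^sub>s \<Gamma>\<^sub>s \<gamma>\<^sub>t \<Gamma>\<^sub>t K x y s t \<longleftrightarrow>
     0 < \<gamma>\<^sub>s \<and> 0 < \<Gamma>\<^sub>s \<and> 0 < \<gamma>\<^sub>t \<and> 0 < \<Gamma>\<^sub>t \<and>
     (\<forall>k<K. norm (s k) \<ge> sqrt (\<gamma>\<^sub>s * \<Gamma>\<^sub>s) * norm (grad_x L (x k) (y k)) \<and>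
            s k \<bullet> grad_x L (x k) (y k) \<ge> (norm (s k))\<^sup>2 / \<Gamma>\<^sub>s \<and>
            norm (t k) \<ge> sqrt (\<gamma>\<^sub>t * \<Gamma>\<^sub>t) * norm (grad_y L (x k) (y k)) \<and>
            t k \<bullet> grad_y L (x k) (y k) \<ge> (norm (t k))\<^sup>2 / \<Gamma>\<^sub>t)"

definition nu_const :: "real \<Rightarrow> real \<Rightarrow> real" where
  "nu_const \<gamma>\<^sub>t \<Gamma>\<^sub>t = (1 - \<gamma>\<^sub>t\<^sup>2 / \<Gamma>\<^sub>t\<^sup>2) powr (- 1 / 3) - 1"

text \<open>Both constants are used only for \<open>\<gamma>\<^sub>t \<le> \<Gamma>\<^sub>t\<close>, so the \<open>else\<close> branches are the case of equality.\<close>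

definition c1_const :: "real \<Rightarrow> real \<Rightarrow> real" where
  "c1_const \<gamma>\<^sub>t \<Gamma>\<^sub>t =
     (if \<gamma>\<^sub>t < \<Gamma>\<^sub>t
      then let \<nu> = nu_const \<gamma>\<^sub>t \<Gamma>\<^sub>t in \<Gamma>\<^sub>t\<^sup>2 / (2 * \<gamma>\<^sub>t) * (\<nu> / (1 + \<nu>))
      else \<Gamma>\<^sub>t\<^sup>2 / (2 * \<gamma>\<^sub>t))"

definition c2_const :: "real \<Rightarrow> real \<Rightarrow> real" where
  "c2_const \<gamma>\<^sub>t \<Gamma>\<^sub>t =
     (if \<gamma>\<^sub>t < \<Gamma>\<^sub>t
      then let \<nu> = nu_const \<gamma>\<^sub>t \<Gamma>\<^sub>t in
             \<Gamma>\<^sub>t\<^sup>2 / (2 * \<gamma>\<^sub>t) * (1 / \<nu>) * (1 / (1 + \<nu>) + 1 + \<nu>)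
      else \<Gamma>\<^sub>t\<^sup>2 / (2 * \<gamma>\<^sub>t))"

definition Delta_y :: "('a \<times> 'b \<Rightarrow> real) \<Rightarrow> 'b \<Rightarrow> 'b \<Rightarrow> real" where
  "Delta_y L ystar y = psi L ystar - psi L y"

definition Delta_x :: "('a \<times> 'b \<Rightarrow> real) \<Rightarrow> 'a \<Rightarrow> 'b \<Rightarrow> real" where
  "Delta_x L x y = L (x, y) - L (xstar L y, y)"

definition Delta :: "('a \<times> 'b \<Rightarrow> real) \<Rightarrow> 'b \<Rightarrow> real \<Rightarrow> real \<Rightarrow> 'a \<Rightarrow> 'b \<Rightarrow> real" where
  "Delta L ystar \<iota> c\<^sub>1 x y = (3 * \<iota> / c\<^sub>1 + 1) * Delta_y L ystar y + Delta_x L x y"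

end

theory Submission
  imports Defs
begin

text \<open>Write \<open>g = \<nabla>\<^sub>yL(x,y)\<close>, \<open>h = \<nabla>\<psi>(y) = \<nabla>\<^sub>yL(x\<^sup>*(y),y)\<close>, \<open>e = h - g\<close>.
  Young's inequality, applied twice with parameter \<open>\<nu>\<close>, gives
  \<open>t \<bullet> h \<ge> c\<^sub>1 \<parallel>h\<parallel>\<^sup>2 - c\<^sub>2 \<parallel>e\<parallel>\<^sup>2\<close>, and strong convexity bounds \<open>\<parallel>e\<parallel>\<close> by a multiple of
  \<open>\<parallel>\<nabla>\<^sub>xL(x,y)\<parallel>\<close>. In the change of \<open>\<Delta>\<close> the increase \<open>P\<close> of \<open>\<psi>\<close> has total weight \<open>-(3\<iota>/c\<^sub>1 + 2)\<close>;
  only \<open>3\<iota>/c\<^sub>1\<close> of it is estimated through \<open>c\<^sub>1, c\<^sub>2\<close>. The remaining \<open>-2P\<close> is combined with the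
  change of \<open>L\<close> under the \<open>y\<close> step: to first order their sum is
  \<open>-\<beta> (t \<bullet> g + 2 t \<bullet> e)\<close>, which is \<open>O(\<beta> \<Gamma>\<^sub>t \<parallel>e\<parallel>\<^sup>2)\<close> because \<open>t \<bullet> g \<ge> \<parallel>t\<parallel>\<^sup>2/\<Gamma>\<^sub>t\<close>.\<close>

section \<open>Gradients as representing vectors of derivatives\<close>

lemma grad_eqI: "GDERIV f x :> D \<Longrightarrow> grad f x = D"
  unfolding grad_def gderiv_def
proof (rule the_equality)
  fix E assume "(f has_derivative (\<lambda>h. h \<bullet> E)) (at x)" "(f has_derivative (\<lambda>h. h \<bullet> D)) (at x)"
  then have "(\<lambda>h. h \<bullet> E) = (\<lambda>h. h \<bullet> D)" by (rule has_derivative_unique)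
  then have "\<forall>h. h \<bullet> (E - D) = 0" by (metis inner_diff_right right_minus_eq)
  then show "E = D" by (metis inner_eq_zero_iff right_minus_eq)
qed

text \<open>In a Euclidean space the derivative is represented by the vector of its values on the
  basis, so a gradient exists; by uniqueness it is the one that \<open>THE\<close> picks in
  \<open>grad\<close>.\<close>

lemma GDERIV_grad:
  fixes f :: "'a::euclidean_space \<Rightarrow> real"
  assumes "f differentiable (at x)"
  shows "GDERIV f x :> grad f x"
proof -
  obtain f' where f': "(f has_derivative f') (at x)"
    using assms by (auto simp: differentiable_def)
  then have lin: "linear f'" by (rule has_derivative_linear)
  have "f' = (\<lambda>h. h \<bullet> (\<Sum>b\<in>Basis. f' b *\<^sub>R b))"
  proof
    fix h
    have "f' h = f' (\<Sum>b\<in>Basis. (h \<bullet> b) *\<^sub>R b)" by (simp add: euclidean_representation)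
    also have "\<dots> = (\<Sum>b\<in>Basis. (h \<bullet> b) * f' b)"
      by (simp add: linear_sum[OF lin] linear_cmul[OF lin])
    finally show "f' h = h \<bullet> (\<Sum>b\<in>Basis. f' b *\<^sub>R b)"
      by (simp add: inner_sum_right mult.commute)
  qed
  then have "GDERIV f x :> (\<Sum>b\<in>Basis. f' b *\<^sub>R b)"
    using f' by (simp add: gderiv_def)
  then show ?thesis using grad_eqI by metis
qed

section \<open>Quadratic bounds from Lipschitz gradients and from strong convexity\<close>

lemma GDERIV_along_line:
  assumes "GDERIV f (u + r *\<^sub>R d) :> D"
  shows "((\<lambda>r. f (u + r *\<^sub>R d)) has_real_derivative d \<bullet> D) (at r)"
proof -
  have "((\<lambda>r. u + r *\<^sub>R d) has_derivative (\<lambda>h. h *\<^sub>R d)) (at r)"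
    by (auto intro!: derivative_eq_intros)
  from has_derivative_compose[OF this assms[unfolded gderiv_def]]
  show ?thesis
    by (simp add: has_field_derivative_def mult_commute_abs)
qed

text \<open>On the line through \<open>u\<close> and \<open>v\<close>, subtracting the linear and
  the quadratic term from \<open>f\<close> leaves \<open>\<phi>\<close>. Cauchy-Schwarz and the
  Lipschitz bound make its derivative nonpositive for \<open>r \<ge> 0\<close>, and the claim is
  \<open>\<phi> 1 \<le> \<phi> 0\<close>.\<close>

lemma lipschitz_gradient_upper:
  fixes f :: "'a::real_inner \<Rightarrow> real"
  assumes G: "\<And>x. GDERIV f x :> G x" and lip: "l-lipschitz_on UNIV G"
  shows "f v \<le> f u + (v - u) \<bullet> G u + l / 2 * (norm (v - u))\<^sup>2"
proof -
  define d where "d = v - u"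
  define \<phi> where "\<phi> r = f (u + r *\<^sub>R d) - r * (d \<bullet> G u) - l * r\<^sup>2 / 2 * (norm d)\<^sup>2" for r
  have deriv: "DERIV \<phi> r :> d \<bullet> G (u + r *\<^sub>R d) - d \<bullet> G u - l * r * (norm d)\<^sup>2" for r
    unfolding \<phi>_def
    by (rule derivative_eq_intros GDERIV_along_line[OF G] refl | simp)+
  have nonpos: "d \<bullet> G (u + r *\<^sub>R d) - d \<bullet> G u - l * r * (norm d)\<^sup>2 \<le> 0" if "0 \<le> r" for r
  proof -
    have "d \<bullet> (G (u + r *\<^sub>R d) - G u) \<le> norm d * norm (G (u + r *\<^sub>R d) - G u)"
      by (rule norm_cauchy_schwarz)
    also have "\<dots> \<le> norm d * (l * norm (r *\<^sub>R d))"
      using lipschitz_onD[OF lip, of "u + r *\<^sub>R d" u]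
      by (intro mult_left_mono) (auto simp: dist_norm)
    also have "\<dots> = l * r * (norm d)\<^sup>2"
      using that by (simp add: power2_eq_square)
    finally show ?thesis by (simp add: inner_diff_right)
  qed
  have "\<phi> 1 \<le> \<phi> 0"
    using deriv nonpos
    by (intro DERIV_nonpos_imp_nonincreasing[of 0 1 \<phi>])
      (auto intro!: exI[of _ "d \<bullet> G (u + r *\<^sub>R d) - d \<bullet> G u - l * r * (norm d)\<^sup>2" for r])
  then show ?thesis by (simp add: \<phi>_def d_def)
qed

lemma lipschitz_gradient_lower:
  fixes f :: "'a::real_inner \<Rightarrow> real"
  assumes G: "\<And>x. GDERIV f x :> G x" and lip: "l-lipschitz_on UNIV G"
  shows "f v \<ge> f u + (v - u) \<bullet> G u - l / 2 * (norm (v - u))\<^sup>2"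
proof -
  have "GDERIV (\<lambda>x. - f x) x :> - G x" for x
    using G[of x] by (rule GDERIV_minus)
  moreover have "l-lipschitz_on UNIV (\<lambda>x. - G x)"
    using lip by (simp add: lipschitz_on_def dist_norm norm_minus_commute)
  ultimately show ?thesis
    using lipschitz_gradient_upper[of "\<lambda>x. - f x" "\<lambda>x. - G x" l v u] by simp
qed

text \<open>The convexity inequality at \<open>v + r *\<^sub>R d\<close> bounds the difference
  quotient of \<open>f\<close> at \<open>v\<close>; letting \<open>r\<close> tend to 0 from the
  right turns the quotient into the directional derivative.\<close>

lemma strongly_convex_gradient:
  fixes f :: "'a::real_inner \<Rightarrow> real"
  assumes sc: "strongly_convex m f" and G: "GDERIV f v :> G"
  shows "f u \<ge> f v + (u - v) \<bullet> G + m / 2 * (norm (u - v))\<^sup>2"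
proof -
  define d where "d = u - v"
  have "((\<lambda>r. f (v + r *\<^sub>R d)) has_real_derivative d \<bullet> G) (at 0)"
    using G by (intro GDERIV_along_line) simp
  then have "((\<lambda>r. (f (v + r *\<^sub>R d) - f v) / r) \<longlongrightarrow> d \<bullet> G) (at_right 0)"
    unfolding has_field_derivative_iff by (auto intro: filterlim_at_within_not_equal tendsto_within_subset)
  moreover have "((\<lambda>r. f u - f v - m / 2 * (1 - r) * (norm d)\<^sup>2)
      \<longlongrightarrow> f u - f v - m / 2 * (1 - 0) * (norm d)\<^sup>2) (at_right 0)"
    by (intro tendsto_intros)
  moreover have "\<forall>\<^sub>F r in at_right 0.
      (f (v + r *\<^sub>R d) - f v) / r \<le> f u - f v - m / 2 * (1 - r) * (norm d)\<^sup>2"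
  proof -
    have "(f (v + r *\<^sub>R d) - f v) / r \<le> f u - f v - m / 2 * (1 - r) * (norm d)\<^sup>2"
      if r: "0 < r" "r < 1" for r
    proof -
      have "f (r *\<^sub>R u + (1 - r) *\<^sub>R v) \<le> r * f u + (1 - r) * f v - m / 2 * r * (1 - r) * (norm (u - v))\<^sup>2"
        using sc r by (auto simp: strongly_convex_def)
      moreover have "r *\<^sub>R u + (1 - r) *\<^sub>R v = v + r *\<^sub>R d"
        by (simp add: d_def algebra_simps)
      ultimately show ?thesis
        using r by (simp add: d_def field_simps)
    qed
    then show ?thesis
      by (auto simp: eventually_at_right_field intro: exI[of _ 1])
  qed
  ultimately have "d \<bullet> G \<le> f u - f v - m / 2 * (1 - 0) * (norm d)\<^sup>2"
    by (intro tendsto_le[of "at_right (0::real)"]) auto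
  then show ?thesis by (simp add: d_def)
qed

lemma strongly_convex_monotone:
  fixes f :: "'a::real_inner \<Rightarrow> real"
  assumes "strongly_convex m f" "GDERIV f u :> Gu" "GDERIV f v :> Gv"
  shows "(u - v) \<bullet> (Gu - Gv) \<ge> m * (norm (u - v))\<^sup>2"
  using strongly_convex_gradient[OF assms(1,2), of v] strongly_convex_gradient[OF assms(1,3), of u]
  by (simp add: inner_diff_right inner_diff_left norm_minus_commute)

text \<open>The lower bound of \<open>strongly_convex_gradient\<close> is quadratic in
  \<open>u - v\<close>; completing the square bounds it below by
  \<open>f v - (norm G)\<^sup>2 / (2 * m)\<close>.\<close>

lemma strongly_convex_PL:
  fixes f :: "'a::real_inner \<Rightarrow> real"
  assumes sc: "strongly_convex m f" and m: "0 < m" and G: "GDERIV f v :> G"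
  shows "2 * m * (f v - f u) \<le> (norm G)\<^sup>2"
proof -
  have "0 \<le> (norm (m *\<^sub>R (u - v) + G))\<^sup>2" by simp
  also have "\<dots> = m\<^sup>2 * (norm (u - v))\<^sup>2 + 2 * m * ((u - v) \<bullet> G) + (norm G)\<^sup>2"
    unfolding power2_norm_eq_inner inner_add_left inner_add_right inner_scaleR_left inner_scaleR_right
    by (simp add: inner_commute power2_eq_square algebra_simps)
  also have "\<dots> = 2 * m * ((u - v) \<bullet> G + m / 2 * (norm (u - v))\<^sup>2) + (norm G)\<^sup>2"
    by (simp add: algebra_simps power2_eq_square)
  also have "\<dots> \<le> 2 * m * (f u - f v) + (norm G)\<^sup>2"
    using strongly_convex_gradient[OF sc G, of u] m by simp
  finally show ?thesis by (simp add: algebra_simps)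
qed

text \<open>Outside the ball of radius \<open>2 * norm (G 0) / m\<close> the quadratic term of the
  lower bound at 0 dominates the linear one, so \<open>f u \<ge> f 0\<close> there, and a minimum
  over the compact ball is global.\<close>

lemma strongly_convex_has_minimum:
  fixes f :: "'a::euclidean_space \<Rightarrow> real"
  assumes sc: "strongly_convex m f" and m: "0 < m" and G: "\<And>x. GDERIV f x :> G x"
  obtains z where "\<And>u. f z \<le> f u"
proof -
  have "continuous_on UNIV f"
    using G unfolding gderiv_def
    by (meson continuous_at_imp_continuous_on has_derivative_continuous)
  then obtain z where z: "\<And>u. u \<in> cball 0 (2 * norm (G 0) / m) \<Longrightarrow> f z \<le> f u"
    using continuous_attains_inf[of "cball 0 (2 * norm (G 0) / m)" f] m continuous_on_subset
    by (metis cball_eq_empty compact_cball divide_nonneg_pos mult_nonneg_nonneg norm_ge_zero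
        not_less subset_UNIV zero_le_numeral)
  have "f z \<le> f u" for u
  proof (cases "u \<in> cball 0 (2 * norm (G 0) / m)")
    case False
    then have "2 * norm (G 0) \<le> m * norm u" using m by (simp add: field_simps)
    then have "norm u * norm (G 0) \<le> m / 2 * (norm u)\<^sup>2"
      using mult_left_mono[of "2 * norm (G 0)" "m * norm u" "norm u"]
      by (simp add: power2_eq_square algebra_simps)
    moreover have "\<bar>u \<bullet> G 0\<bar> \<le> norm u * norm (G 0)" by (rule Cauchy_Schwarz_ineq2)
    ultimately have "f 0 \<le> f u"
      using strongly_convex_gradient[OF sc G, of 0 u] by simp
    moreover have "f z \<le> f 0" using z m by simp
    ultimately show ?thesis by simp
  qed (rule z)
  then show ?thesis by (rule that)
qed

text \<open>The derivative in the direction \<open>D\<close> itself is \<open>D \<bullet> D\<close>,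
  which vanishes at a minimum.\<close>

lemma GDERIV_minimum_zero:
  fixes f :: "'a::real_inner \<Rightarrow> real"
  assumes "GDERIV f z :> D" "\<And>u. f z \<le> f u"
  shows "D = 0"
proof -
  have "((\<lambda>r. f (z + r *\<^sub>R D)) has_real_derivative D \<bullet> D) (at 0)"
    using assms(1) by (intro GDERIV_along_line) simp
  then have "D \<bullet> D = 0"
    by (rule DERIV_local_min[where d = 1]) (use assms(2) in auto)
  then show ?thesis by simp
qed

section \<open>Search directions and the constants \<open>c\<^sub>1\<close>,
  \<open>c\<^sub>2\<close>\<close>

lemma norm_add_power2_le:
  fixes a b :: "'a::real_inner"
  assumes "0 < \<nu>"
  shows "(norm (a + b))\<^sup>2 \<le> (1 + \<nu>) * (norm a)\<^sup>2 + (1 + 1 / \<nu>) * (norm b)\<^sup>2"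
proof -
  have "0 \<le> (norm (\<nu> *\<^sub>R a - b))\<^sup>2 / \<nu>" using assms by simp
  also have "\<dots> = \<nu> * (norm a)\<^sup>2 + (norm b)\<^sup>2 / \<nu> - 2 * (a \<bullet> b)"
    unfolding power2_norm_eq_inner inner_diff_left inner_diff_right inner_scaleR_left inner_scaleR_right
    using assms by (simp add: inner_commute field_simps power2_eq_square)
  finally show ?thesis
    by (simp add: power2_norm_eq_inner inner_add_left inner_add_right inner_commute algebra_simps)
qed

text \<open>Cauchy-Schwarz turns the angle condition into
  \<open>norm t \<le> \<Gamma> * norm g\<close>; inserting the length condition into the angle
  condition gives the factor \<open>\<gamma> * \<Gamma> / \<Gamma> = \<gamma>\<close>.\<close>

lemma direction_bounds:
  fixes t g :: "'a::real_inner"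
  assumes pos: "0 < \<gamma>" "0 < \<Gamma>"
    and len: "norm t \<ge> sqrt (\<gamma> * \<Gamma>) * norm g" and angle: "t \<bullet> g \<ge> (norm t)\<^sup>2 / \<Gamma>"
  shows "(norm t)\<^sup>2 \<le> \<Gamma>\<^sup>2 * (norm g)\<^sup>2" and "t \<bullet> g \<ge> \<gamma> * (norm g)\<^sup>2"
proof -
  have "(norm t)\<^sup>2 \<le> \<Gamma> * (t \<bullet> g)" using angle pos by (simp add: field_simps)
  also have "\<dots> \<le> \<Gamma> * (norm t * norm g)"
    using pos by (intro mult_left_mono norm_cauchy_schwarz) auto
  finally have "norm t * norm t \<le> norm t * (\<Gamma> * norm g)"
    by (simp add: power2_eq_square algebra_simps)
  then have "norm t \<le> \<Gamma> * norm g"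
    using pos by (cases "t = 0") auto
  from power_mono[OF this, of 2] show "(norm t)\<^sup>2 \<le> \<Gamma>\<^sup>2 * (norm g)\<^sup>2"
    by (simp add: power_mult_distrib)
  have "(sqrt (\<gamma> * \<Gamma>) * norm g)\<^sup>2 \<le> (norm t)\<^sup>2"
    using len pos by (intro power_mono) auto
  then have "\<gamma> * \<Gamma> * (norm g)\<^sup>2 \<le> (norm t)\<^sup>2"
    using pos by (simp add: power_mult_distrib)
  then have "\<gamma> * (norm g)\<^sup>2 \<le> (norm t)\<^sup>2 / \<Gamma>"
    using pos by (simp add: field_simps)
  then show "t \<bullet> g \<ge> \<gamma> * (norm g)\<^sup>2" using angle by simp
qed

text \<open>Here \<open>q = 1 / (1 + \<nu>)\<close>.\<close>

lemma c_consts_cube_root: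
  assumes "0 < \<gamma>" "\<gamma> < \<Gamma>"
  obtains q where "0 < q" "q < 1" "q ^ 3 = 1 - \<gamma>\<^sup>2 / \<Gamma>\<^sup>2"
    "c1_const \<gamma> \<Gamma> = \<Gamma>\<^sup>2 / (2 * \<gamma>) * (1 - q)"
    "c2_const \<gamma> \<Gamma> = \<Gamma>\<^sup>2 / (2 * \<gamma>) * ((q\<^sup>2 + 1) / (1 - q))"
proof -
  define w where "w = 1 - \<gamma>\<^sup>2 / \<Gamma>\<^sup>2"
  have "\<gamma>\<^sup>2 < \<Gamma>\<^sup>2" using assms by (intro power_strict_mono) auto
  then have w: "0 < w" "w < 1" using assms by (auto simp: w_def field_simps)
  define q where "q = w powr (1 / 3)"
  have q: "0 < q" using w by (simp add: q_def)
  have q3: "q ^ 3 = w" using w by (simp add: q_def powr_power)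
  have "q < 1"
  proof (rule ccontr)
    assume "\<not> q < 1"
    then have "1 \<le> q ^ 3" by (intro one_le_power) simp
    then show False using q3 w by simp
  qed
  have nu: "nu_const \<gamma> \<Gamma> = (1 - q) / q"
    using q by (simp add: nu_const_def q_def w_def[symmetric] powr_minus_divide field_simps)
  show ?thesis
  proof (rule that[OF q \<open>q < 1\<close> q3[unfolded w_def]])
    show "c1_const \<gamma> \<Gamma> = \<Gamma>\<^sup>2 / (2 * \<gamma>) * (1 - q)"
      using q \<open>q < 1\<close> assms by (simp add: c1_const_def Let_def nu field_simps)
    show "c2_const \<gamma> \<Gamma> = \<Gamma>\<^sup>2 / (2 * \<gamma>) * ((q\<^sup>2 + 1) / (1 - q))"
      using q \<open>q < 1\<close> assms
      by (simp add: c2_const_def Let_def nu divide_simps power2_eq_square) (simp add: algebra_simps)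
  qed
qed

lemma c1_const_pos:
  assumes "0 < \<gamma>" "\<gamma> \<le> \<Gamma>"
  shows "0 < c1_const \<gamma> \<Gamma>"
proof (cases "\<gamma> < \<Gamma>")
  case True
  then obtain q where "0 < q" "q < 1" "c1_const \<gamma> \<Gamma> = \<Gamma>\<^sup>2 / (2 * \<gamma>) * (1 - q)"
    using c_consts_cube_root assms(1) by metis
  then show ?thesis using assms by simp
qed (use assms in \<open>simp add: c1_const_def\<close>)

lemma c2_const_pos:
  assumes "0 < \<gamma>" "\<gamma> \<le> \<Gamma>"
  shows "0 < c2_const \<gamma> \<Gamma>"
proof (cases "\<gamma> < \<Gamma>")
  case True
  then obtain q where "0 < q" "q < 1" "c2_const \<gamma> \<Gamma> = \<Gamma>\<^sup>2 / (2 * \<gamma>) * ((q\<^sup>2 + 1) / (1 - q))"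
    using c_consts_cube_root assms(1) by metis
  moreover have "0 < q\<^sup>2 + 1" by (simp add: add_nonneg_pos)
  ultimately show ?thesis using assms by simp
qed (use assms in \<open>simp add: c2_const_def\<close>)

text \<open>For \<open>q\<close> between 0 and 1,
  \<open>1 - q \<le> 1 - q ^ 3 = \<gamma>\<^sup>2 / \<Gamma>\<^sup>2\<close>. The bound later lets
  terms with \<open>c\<^sub>1\<close> be absorbed by terms with
  \<open>\<Gamma>\<^sub>t\<close>.\<close>

lemma c1_const_le:
  assumes "0 < \<gamma>" "\<gamma> \<le> \<Gamma>"
  shows "c1_const \<gamma> \<Gamma> \<le> \<gamma> / 2"
proof (cases "\<gamma> < \<Gamma>")
  case True
  then obtain q where q: "0 < q" "q < 1" "q ^ 3 = 1 - \<gamma>\<^sup>2 / \<Gamma>\<^sup>2"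
      "c1_const \<gamma> \<Gamma> = \<Gamma>\<^sup>2 / (2 * \<gamma>) * (1 - q)"
    using c_consts_cube_root assms(1) by metis
  have "q ^ 3 \<le> q ^ 1" using q by (intro power_decreasing) auto
  then have "\<Gamma>\<^sup>2 / (2 * \<gamma>) * (1 - q) \<le> \<Gamma>\<^sup>2 / (2 * \<gamma>) * (\<gamma>\<^sup>2 / \<Gamma>\<^sup>2)"
    using q assms by (intro mult_left_mono) auto
  also have "\<dots> = \<gamma> / 2" using assms by (simp add: field_simps power2_eq_square)
  finally show ?thesis using q by simp
qed (use assms in \<open>simp add: c1_const_def field_simps power2_eq_square\<close>)

text \<open>The direction \<open>t\<close> is close to \<open>a *\<^sub>R g\<close>, with relative
  squared error at most \<open>q ^ 3\<close>. Passing from \<open>g\<close> to \<open>h\<close> uses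
  Young's inequality twice, each time at the cost of a factor \<open>1 / q\<close>, so
  \<open>q < 1\<close> remains and \<open>1 - q\<close> becomes the factor in
  \<open>c\<^sub>1\<close>. This explains the cube root in \<nu>.\<close>

lemma direction_inner_lower:
  fixes t g h :: "'a::real_inner"
  assumes pos: "0 < \<gamma>" "\<gamma> \<le> \<Gamma>"
    and len: "norm t \<ge> sqrt (\<gamma> * \<Gamma>) * norm g" and angle: "t \<bullet> g \<ge> (norm t)\<^sup>2 / \<Gamma>"
  shows "t \<bullet> h \<ge> c1_const \<gamma> \<Gamma> * (norm h)\<^sup>2 - c2_const \<gamma> \<Gamma> * (norm (h - g))\<^sup>2"
proof -
  \<comment> \<open>This multiple minimizes the relative error bound \<open>(\<Gamma>\<^sup>2 - 2 *
    a * \<gamma> + a\<^sup>2) / a\<^sup>2\<close>; the minimum is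
    \<open>1 - \<gamma>\<^sup>2 / \<Gamma>\<^sup>2\<close>.\<close>
  define a where "a = \<Gamma>\<^sup>2 / \<gamma>"
  have a: "0 < a" and a_gamma: "a * \<gamma> = \<Gamma>\<^sup>2" using pos by (auto simp: a_def)
  have "0 < \<Gamma>" using pos by simp
  note b = direction_bounds[OF pos(1) \<open>0 < \<Gamma>\<close> len angle]
  have "(norm (t - a *\<^sub>R g))\<^sup>2 = (norm t)\<^sup>2 - 2 * a * (t \<bullet> g) + a\<^sup>2 * (norm g)\<^sup>2"
    unfolding power2_norm_eq_inner inner_diff_left inner_diff_right inner_scaleR_left inner_scaleR_right
    by (simp add: inner_commute power2_eq_square algebra_simps)
  also have "\<dots> \<le> \<Gamma>\<^sup>2 * (norm g)\<^sup>2 - 2 * a * (\<gamma> * (norm g)\<^sup>2) + a\<^sup>2 * (norm g)\<^sup>2"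
    using b a by (intro add_mono diff_mono mult_left_mono) auto
  also have "\<dots> = (a\<^sup>2 - \<Gamma>\<^sup>2) * (norm g)\<^sup>2"
    using a_gamma by (simp add: algebra_simps)
  also have "a\<^sup>2 - \<Gamma>\<^sup>2 = a\<^sup>2 * (1 - \<gamma>\<^sup>2 / \<Gamma>\<^sup>2)"
    using pos by (simp add: a_def field_simps power2_eq_square)
  finally have tag: "(norm (t - a *\<^sub>R g))\<^sup>2 \<le> a\<^sup>2 * (1 - \<gamma>\<^sup>2 / \<Gamma>\<^sup>2) * (norm g)\<^sup>2" .
  have expand: "(norm (t - a *\<^sub>R h))\<^sup>2 = (norm t)\<^sup>2 - 2 * a * (t \<bullet> h) + a\<^sup>2 * (norm h)\<^sup>2"
    unfolding power2_norm_eq_inner inner_diff_left inner_diff_right inner_scaleR_left inner_scaleR_right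
    by (simp add: inner_commute power2_eq_square algebra_simps)
  have split: "t - a *\<^sub>R h = (t - a *\<^sub>R g) + a *\<^sub>R (g - h)" by (simp add: algebra_simps)
  show ?thesis
  proof (cases "\<gamma> < \<Gamma>")
    case True
    then obtain q where q: "0 < q" "q < 1" "q ^ 3 = 1 - \<gamma>\<^sup>2 / \<Gamma>\<^sup>2"
      and c: "c1_const \<gamma> \<Gamma> = \<Gamma>\<^sup>2 / (2 * \<gamma>) * (1 - q)"
      "c2_const \<gamma> \<Gamma> = \<Gamma>\<^sup>2 / (2 * \<gamma>) * ((q\<^sup>2 + 1) / (1 - q))"
      using c_consts_cube_root pos(1) by metis
    define \<nu> where "\<nu> = (1 - q) / q"
    have nu: "0 < \<nu>" "1 + \<nu> = 1 / q" "1 + 1 / \<nu> = 1 / (1 - q)"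
      using q by (auto simp: \<nu>_def field_simps)
    have "(norm (t - a *\<^sub>R h))\<^sup>2
        \<le> 1 / q * (norm (t - a *\<^sub>R g))\<^sup>2 + 1 / (1 - q) * (norm (a *\<^sub>R (g - h)))\<^sup>2"
      unfolding split using norm_add_power2_le[OF nu(1)] nu by metis
    also have "\<dots> \<le> 1 / q * (a\<^sup>2 * q ^ 3 * (norm g)\<^sup>2) + 1 / (1 - q) * (a\<^sup>2 * (norm (h - g))\<^sup>2)"
      using tag q by (intro add_mono mult_left_mono)
        (auto simp: power_mult_distrib norm_minus_commute)
    also have "\<dots> = a\<^sup>2 * (q\<^sup>2 * (norm g)\<^sup>2 + 1 / (1 - q) * (norm (h - g))\<^sup>2)"
      using q by (simp add: field_simps power2_eq_square power3_eq_cube)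
    \<comment> \<open>Second use of Young's inequality, now for
      \<open>g = h + (g - h)\<close>.\<close>
    also have "\<dots> \<le> a\<^sup>2 * (q\<^sup>2 * (1 / q * (norm h)\<^sup>2 + 1 / (1 - q) * (norm (h - g))\<^sup>2)
        + 1 / (1 - q) * (norm (h - g))\<^sup>2)"
      using norm_add_power2_le[OF nu(1), of h "g - h"] nu q
      by (intro mult_left_mono add_mono) (auto simp: norm_minus_commute)
    also have "\<dots> = a\<^sup>2 * (q * (norm h)\<^sup>2 + (q\<^sup>2 + 1) / (1 - q) * (norm (h - g))\<^sup>2)"
      using q by (simp add: divide_simps power2_eq_square) (simp add: algebra_simps)
    finally have "2 * a * (t \<bullet> h) \<ge> (norm t)\<^sup>2 + a\<^sup>2 * (norm h)\<^sup>2
        - a\<^sup>2 * (q * (norm h)\<^sup>2 + (q\<^sup>2 + 1) / (1 - q) * (norm (h - g))\<^sup>2)"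
      using expand by simp
    moreover define w where "w = (q\<^sup>2 + 1) / (1 - q)"
    ultimately have "2 * a * (t \<bullet> h) \<ge> a\<^sup>2 * (norm h)\<^sup>2 - a\<^sup>2 * (q * (norm h)\<^sup>2 + w * (norm (h - g))\<^sup>2)"
      unfolding w_def using zero_le_power2[of "norm t"] by linarith
    also have "a\<^sup>2 * (norm h)\<^sup>2 - a\<^sup>2 * (q * (norm h)\<^sup>2 + w * (norm (h - g))\<^sup>2)
        = 2 * a * (a / 2 * (1 - q) * (norm h)\<^sup>2 - a / 2 * w * (norm (h - g))\<^sup>2)"
      by (simp add: algebra_simps power2_eq_square)
    finally have "a / 2 * (1 - q) * (norm h)\<^sup>2 - a / 2 * w * (norm (h - g))\<^sup>2 \<le> t \<bullet> h"
      using a by simp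
    then show ?thesis by (simp add: c a_def w_def mult.commute)
  next
    case False
    then have eq: "\<gamma> = \<Gamma>" using pos by simp
    then have "a = \<Gamma>" using pos by (simp add: a_def power2_eq_square)
    \<comment> \<open>With equal constants the error bound is zero, so \<open>t\<close> is exactly a
      multiple of \<open>g\<close> and polarization computes \<open>t \<bullet> h\<close>.\<close>
    have "(norm (t - a *\<^sub>R g))\<^sup>2 \<le> 0" using tag eq pos by simp
    then have t: "t = \<Gamma> *\<^sub>R g" using \<open>a = \<Gamma>\<close> by simp
    have "t \<bullet> h = \<Gamma> / 2 * ((norm g)\<^sup>2 + (norm h)\<^sup>2 - (norm (h - g))\<^sup>2)"
      unfolding t power2_norm_eq_inner inner_diff_left inner_diff_right by (simp add: inner_commute)
    also have "\<dots> \<ge> \<Gamma> / 2 * ((norm h)\<^sup>2 - (norm (h - g))\<^sup>2)"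
      using pos by (intro mult_left_mono) auto
    finally show ?thesis
      using eq pos by (simp add: c1_const_def c2_const_def algebra_simps power2_eq_square)
  qed
qed

text \<open>Used to differentiate \<open>psi\<close>: a two-sided quadratic estimate around the
  candidate gradient is enough, and \<open>xstar\<close> itself is never differentiated.\<close>

lemma GDERIV_quadratic_remainder:
  fixes f :: "'a::real_inner \<Rightarrow> real"
  assumes "\<And>z. \<bar>f z - f x - (z - x) \<bullet> D\<bar> \<le> C * (norm (z - x))\<^sup>2"
  shows "GDERIV f x :> D"
  unfolding gderiv_def
proof (rule has_derivativeI_sandwich[where e = 1 and H = "\<lambda>z. C * norm (z - x)"])
  show "bounded_linear (\<lambda>h. h \<bullet> D)" by (rule bounded_linear_inner_left)
  show "norm (f z - f x - (z - x) \<bullet> D) / norm (z - x) \<le> C * norm (z - x)" if "z \<noteq> x" for z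
    using assms[of z] that by (simp add: divide_le_eq power2_eq_square mult.assoc)
  have "((\<lambda>z. C * norm (z - x)) \<longlongrightarrow> C * norm (x - x)) (at x)"
    by (intro tendsto_intros)
  then show "((\<lambda>z. C * norm (z - x)) \<longlongrightarrow> 0) (at x)" by simp
qed simp

section \<open>Inner minimization: the minimizer map and the value function\<close>

locale regular_minimax =
  fixes L :: "'a::euclidean_space \<times> 'b::euclidean_space \<Rightarrow> real"
    and m\<^sub>x l\<^sub>x\<^sub>x l\<^sub>x\<^sub>y l\<^sub>y\<^sub>x l\<^sub>y\<^sub>y :: real
  assumes regular: "regular L m\<^sub>x l\<^sub>x\<^sub>x l\<^sub>x\<^sub>y l\<^sub>y\<^sub>x l\<^sub>y\<^sub>y"
begin

lemma constants: "0 < m\<^sub>x" "m\<^sub>x < l\<^sub>x\<^sub>x" "0 \<le> l\<^sub>x\<^sub>y" "0 \<le> l\<^sub>y\<^sub>x" "0 \<le> l\<^sub>y\<^sub>y"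
  using regular by (auto simp: regular_def)

lemma strongly_convex: "strongly_convex m\<^sub>x (\<lambda>x. L (x, y))"
  using regular by (auto simp: regular_def)

lemma lipschitz:
  "l\<^sub>x\<^sub>x-lipschitz_on UNIV (\<lambda>x. grad_x L x y)" "l\<^sub>x\<^sub>y-lipschitz_on UNIV (\<lambda>y. grad_x L x y)"
  "l\<^sub>y\<^sub>x-lipschitz_on UNIV (\<lambda>x. grad_y L x y)" "l\<^sub>y\<^sub>y-lipschitz_on UNIV (\<lambda>y. grad_y L x y)"
  using regular by (auto simp: regular_def)

lemma differentiable: "L differentiable (at z)"
  using regular unfolding regular_def twice_differentiable_def by blast

lemma GDERIV_x: "GDERIV (\<lambda>u. L (u, y)) x :> grad_x L x y"
proof -
  obtain L' where L': "(L has_derivative L') (at (x, y))"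
    using differentiable by (auto simp: differentiable_def)
  have "((\<lambda>u. (u, y)) has_derivative (\<lambda>h. (h, 0))) (at x)"
    by (auto intro!: derivative_eq_intros)
  from has_derivative_compose[OF this L'] show ?thesis
    unfolding grad_x_def by (intro GDERIV_grad) (auto simp: differentiable_def)
qed

lemma GDERIV_y: "GDERIV (\<lambda>v. L (x, v)) y :> grad_y L x y"
proof -
  obtain L' where L': "(L has_derivative L') (at (x, y))"
    using differentiable by (auto simp: differentiable_def)
  have "((\<lambda>v. (x, v)) has_derivative (\<lambda>h. (0, h))) (at y)"
    by (auto intro!: derivative_eq_intros)
  from has_derivative_compose[OF this L'] show ?thesis
    unfolding grad_y_def by (intro GDERIV_grad) (auto simp: differentiable_def)
qed

text \<open>\<open>xstar\<close> is a choice made by \<open>ARG_MIN\<close>, so its minimality rests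
  on the existence of some minimizer, which strong convexity supplies.\<close>

lemma xstar_le: "L (xstar L y, y) \<le> L (u, y)"
proof -
  obtain z where "\<And>u. L (z, y) \<le> L (u, y)"
    using strongly_convex_has_minimum[OF strongly_convex constants(1) GDERIV_x] by blast
  then have "is_arg_min (\<lambda>x. L (x, y)) (\<lambda>_. True) z"
    by (auto simp: is_arg_min_def not_less)
  then have "is_arg_min (\<lambda>x. L (x, y)) (\<lambda>_. True) (xstar L y)"
    unfolding xstar_def arg_min_def by (rule someI)
  then show ?thesis by (auto simp: is_arg_min_def not_less)
qed

lemma grad_x_xstar: "grad_x L (xstar L y) y = 0"
  using GDERIV_minimum_zero[OF GDERIV_x] xstar_le by blast

text \<open>Strong monotonicity is applied between \<open>u\<close> and the minimizer, where the
  gradient vanishes; Cauchy-Schwarz then cancels one factor of the distance.\<close>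

lemma norm_diff_xstar_le: "m\<^sub>x * norm (u - xstar L y) \<le> norm (grad_x L u y)"
proof (cases "u = xstar L y")
  case False
  have "m\<^sub>x * (norm (u - xstar L y))\<^sup>2 \<le> (u - xstar L y) \<bullet> grad_x L u y"
    using strongly_convex_monotone[OF strongly_convex GDERIV_x GDERIV_x, of u "xstar L y" y]
    by (simp add: grad_x_xstar)
  also have "\<dots> \<le> norm (u - xstar L y) * norm (grad_x L u y)"
    by (rule norm_cauchy_schwarz)
  finally show ?thesis
    using False by (simp add: power2_eq_square mult.left_commute)
qed simp

text \<open>The gradient at \<open>(xstar L v, y)\<close> controls the distance to
  \<open>xstar L y\<close>, and it differs from the vanishing gradient at
  \<open>(xstar L v, v)\<close> only through the second argument.\<close>

lemma norm_xstar_diff_le: "m\<^sub>x * norm (xstar L v - xstar L y) \<le> l\<^sub>x\<^sub>y * norm (v - y)"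
proof -
  have "m\<^sub>x * norm (xstar L v - xstar L y) \<le> norm (grad_x L (xstar L v) y)"
    by (rule norm_diff_xstar_le)
  also have "\<dots> = dist (grad_x L (xstar L v) v) (grad_x L (xstar L v) y)"
    by (simp add: grad_x_xstar dist_norm)
  also have "\<dots> \<le> l\<^sub>x\<^sub>y * dist v y"
    by (rule lipschitz_onD[OF lipschitz(2)]) auto
  finally show ?thesis by (simp add: dist_norm)
qed

lemma grad_y_error:
  "m\<^sub>x * norm (grad_y L (xstar L y) y - grad_y L u y) \<le> l\<^sub>y\<^sub>x * norm (grad_x L u y)"
proof -
  have "norm (grad_y L (xstar L y) y - grad_y L u y) \<le> l\<^sub>y\<^sub>x * norm (u - xstar L y)"
    using lipschitz_onD[OF lipschitz(3), of "xstar L y" u y]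
    by (simp add: dist_norm norm_minus_commute)
  then have "m\<^sub>x * norm (grad_y L (xstar L y) y - grad_y L u y) \<le> m\<^sub>x * (l\<^sub>y\<^sub>x * norm (u - xstar L y))"
    using constants by (intro mult_left_mono) auto
  also have "\<dots> = l\<^sub>y\<^sub>x * (m\<^sub>x * norm (u - xstar L y))" by simp
  also have "\<dots> \<le> l\<^sub>y\<^sub>x * norm (grad_x L u y)"
    using constants norm_diff_xstar_le by (intro mult_left_mono) auto
  finally show ?thesis .
qed

lemma norm_grad_y_xstar_diff_le:
  "norm (grad_y L (xstar L v) y - grad_y L (xstar L y) y) \<le> l\<^sub>y\<^sub>x * l\<^sub>x\<^sub>y / m\<^sub>x * norm (v - y)"
proof -
  have "norm (xstar L v - xstar L y) \<le> l\<^sub>x\<^sub>y * norm (v - y) / m\<^sub>x"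
    using norm_xstar_diff_le[of v y] constants by (simp add: field_simps)
  then have "l\<^sub>y\<^sub>x * norm (xstar L v - xstar L y) \<le> l\<^sub>y\<^sub>x * (l\<^sub>x\<^sub>y * norm (v - y) / m\<^sub>x)"
    using constants by (intro mult_left_mono) auto
  then show ?thesis
    using lipschitz_onD[OF lipschitz(3), of "xstar L v" "xstar L y" y] by (simp add: dist_norm)
qed

lemma L_y_step:
  "L (u, v) \<le> L (u, y) + (v - y) \<bullet> grad_y L u y + l\<^sub>y\<^sub>y / 2 * (norm (v - y))\<^sup>2"
  "L (u, v) \<ge> L (u, y) + (v - y) \<bullet> grad_y L u y - l\<^sub>y\<^sub>y / 2 * (norm (v - y))\<^sup>2"
  by (rule lipschitz_gradient_upper[OF GDERIV_y lipschitz(4)],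
      rule lipschitz_gradient_lower[OF GDERIV_y lipschitz(4)])

lemma L_x_step:
  "L (v, y) \<le> L (u, y) + (v - u) \<bullet> grad_x L u y + l\<^sub>x\<^sub>x / 2 * (norm (v - u))\<^sup>2"
  by (rule lipschitz_gradient_upper[OF GDERIV_x lipschitz(1)])

text \<open>Envelope argument. For the upper bound the minimizer is frozen at
  \<open>xstar L y\<close>; for the lower bound it is frozen at \<open>xstar L v\<close>, and
  Lipschitz continuity of \<open>xstar\<close> makes the resulting change of gradient a quadratic
  error.\<close>

lemma GDERIV_psi: "GDERIV (psi L) y :> grad_y L (xstar L y) y"
proof (rule GDERIV_quadratic_remainder)
  fix v
  let ?c = "l\<^sub>y\<^sub>x * l\<^sub>x\<^sub>y / m\<^sub>x" and ?d = "grad_y L (xstar L v) y - grad_y L (xstar L y) y"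
  have c: "0 \<le> ?c" using constants by simp
  have "psi L v \<le> L (xstar L y, v)"
    unfolding psi_def by (rule xstar_le)
  then have upper: "psi L v - psi L y - (v - y) \<bullet> grad_y L (xstar L y) y \<le> l\<^sub>y\<^sub>y / 2 * (norm (v - y))\<^sup>2"
    using L_y_step(1)[of "xstar L y" v y] by (simp add: psi_def)
  have "\<bar>(v - y) \<bullet> ?d\<bar> \<le> norm (v - y) * norm ?d" by (rule Cauchy_Schwarz_ineq2)
  also have "\<dots> \<le> norm (v - y) * (?c * norm (v - y))"
    by (intro mult_left_mono norm_grad_y_xstar_diff_le) auto
  finally have d: "- (?c * (norm (v - y))\<^sup>2) \<le> (v - y) \<bullet> ?d"
    by (simp add: power2_eq_square mult_ac abs_le_iff)
  have "psi L y \<le> L (xstar L v, y)"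
    unfolding psi_def by (rule xstar_le)
  then have lower: "- (l\<^sub>y\<^sub>y / 2 * (norm (v - y))\<^sup>2) - ?c * (norm (v - y))\<^sup>2
      \<le> psi L v - psi L y - (v - y) \<bullet> grad_y L (xstar L y) y"
    using L_y_step(2)[of "xstar L v" y v] d by (simp add: psi_def inner_diff_right)
  have "0 \<le> ?c * (norm (v - y))\<^sup>2" using c by (intro mult_nonneg_nonneg) auto
  with upper lower show "\<bar>psi L v - psi L y - (v - y) \<bullet> grad_y L (xstar L y) y\<bar>
      \<le> (l\<^sub>y\<^sub>y / 2 + ?c) * (norm (v - y))\<^sup>2"
    unfolding abs_le_iff distrib_right by linarith
qed

text \<open>Through the intermediate value \<open>grad_y L (xstar L v) y\<close>, the two summands
  of the constant account for the change of \<open>y\<close> and for the change of the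
  minimizer.\<close>

lemma psi_gradient_lipschitz:
  "(l\<^sub>y\<^sub>y + l\<^sub>y\<^sub>x * l\<^sub>x\<^sub>y / m\<^sub>x)-lipschitz_on UNIV (\<lambda>y. grad_y L (xstar L y) y)"
proof (rule lipschitz_onI)
  fix v y
  have "dist (grad_y L (xstar L v) v) (grad_y L (xstar L y) y)
      \<le> dist (grad_y L (xstar L v) v) (grad_y L (xstar L v) y)
       + dist (grad_y L (xstar L v) y) (grad_y L (xstar L y) y)"
    by (rule dist_triangle)
  also have "\<dots> \<le> l\<^sub>y\<^sub>y * dist v y + l\<^sub>y\<^sub>x * l\<^sub>x\<^sub>y / m\<^sub>x * dist v y"
    using norm_grad_y_xstar_diff_le[of v y]
    by (intro add_mono lipschitz_onD[OF lipschitz(4)]) (auto simp: dist_norm)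
  finally show "dist (grad_y L (xstar L v) v) (grad_y L (xstar L y) y)
      \<le> (l\<^sub>y\<^sub>y + l\<^sub>y\<^sub>x * l\<^sub>x\<^sub>y / m\<^sub>x) * dist v y"
    by (simp add: distrib_right)
qed (use constants in auto)

end

section \<open>Decrease of \<open>Delta\<close> in one step\<close>

context regular_minimax
begin

text \<open>The decrease is stated in gradients; the PL inequality and strong convexity convert them
  into \<open>Delta_y\<close> and \<open>Delta_x\<close> afterwards. The change of \<open>L\<close>
  is split into the \<open>x\<close> step at the old \<open>y\<close> (\<open>B\<close>) and the
  \<open>y\<close> step at the new \<open>x\<close> (\<open>A\<close>), so \<open>Delta\<close>
  changes by \<open>- (3 * \<iota> / c\<^sub>1 + 2) * P + A + B\<close>.\<close>

lemma Delta_step: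
  fixes \<alpha> \<beta> \<gamma>\<^sub>s \<Gamma>\<^sub>s \<gamma>\<^sub>t \<Gamma>\<^sub>t :: real
  defines "l\<^sub>\<psi> \<equiv> l\<^sub>y\<^sub>y + l\<^sub>y\<^sub>x * l\<^sub>x\<^sub>y / m\<^sub>x"
    and "c\<^sub>1 \<equiv> c1_const \<gamma>\<^sub>t \<Gamma>\<^sub>t" and "c\<^sub>2 \<equiv> c2_const \<gamma>\<^sub>t \<Gamma>\<^sub>t"
  defines "\<iota> \<equiv> 2 * \<Gamma>\<^sub>t + \<Gamma>\<^sub>t\<^sup>2 + c\<^sub>1 * l\<^sub>y\<^sub>y / (3 * l\<^sub>\<psi>)"
  assumes pos: "0 < \<alpha>" "0 < \<beta>" "0 < \<gamma>\<^sub>s" "0 < \<Gamma>\<^sub>s" "0 < \<gamma>\<^sub>t" "\<gamma>\<^sub>t \<le> \<Gamma>\<^sub>t" "0 < l\<^sub>\<psi>"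
    and s: "norm s \<ge> sqrt (\<gamma>\<^sub>s * \<Gamma>\<^sub>s) * norm (grad_x L u y)"
      "s \<bullet> grad_x L u y \<ge> (norm s)\<^sup>2 / \<Gamma>\<^sub>s"
    and t: "norm t \<ge> sqrt (\<gamma>\<^sub>t * \<Gamma>\<^sub>t) * norm (grad_y L u y)"
      "t \<bullet> grad_y L u y \<ge> (norm t)\<^sup>2 / \<Gamma>\<^sub>t"
    and alpha: "\<alpha> \<le> 2 * \<gamma>\<^sub>s / (\<Gamma>\<^sub>s\<^sup>2 * (3 * l\<^sub>x\<^sub>x + c\<^sub>1 * l\<^sub>y\<^sub>x\<^sup>2 / (l\<^sub>\<psi> * \<Gamma>\<^sub>t\<^sup>2)))"
    and beta: "\<beta> \<le> c\<^sub>1 / (3 * l\<^sub>\<psi> * \<Gamma>\<^sub>t\<^sup>2)"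
    and beta': "l\<^sub>y\<^sub>x \<noteq> 0 \<Longrightarrow> \<beta> \<le> \<alpha> * \<gamma>\<^sub>s * m\<^sub>x\<^sup>2 * c\<^sub>1 / (3 * l\<^sub>y\<^sub>x\<^sup>2 * \<iota> * (3 * c\<^sub>2 + 2 * c\<^sub>1))"
  shows "Delta L ystar \<iota> c\<^sub>1 (u - \<alpha> *\<^sub>R s) (y + \<beta> *\<^sub>R t) \<le> Delta L ystar \<iota> c\<^sub>1 u y
    - \<beta> * \<iota> * (norm (grad_y L (xstar L y) y))\<^sup>2 - \<alpha> * \<gamma>\<^sub>s / 3 * (norm (grad_x L u y))\<^sup>2"
proof -
  define g where "g = grad_y L u y"
  define h where "h = grad_y L (xstar L y) y"
  define u' where "u' = u - \<alpha> *\<^sub>R s"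
  define y' where "y' = y + \<beta> *\<^sub>R t"
  define E where "E = (norm (h - g))\<^sup>2"
  define H where "H = (norm h)\<^sup>2"
  define X where "X = (norm (grad_x L u y))\<^sup>2"
  define N where "N = (norm s)\<^sup>2"
  define T where "T = (norm t)\<^sup>2"
  \<comment> \<open>Scaled so that \<open>\<tau> \<le> (norm g)\<^sup>2\<close>.\<close>
  define \<tau> where "\<tau> = T / \<Gamma>\<^sub>t\<^sup>2"
  define P where "P = psi L y' - psi L y"
  define A where "A = L (u', y') - L (u', y)"
  define B where "B = L (u', y) - L (u, y)"
  have Gt: "0 < \<Gamma>\<^sub>t" using pos by simp
  have c: "0 < c\<^sub>1" "0 < c\<^sub>2" "c\<^sub>1 \<le> \<Gamma>\<^sub>t / 2"
    using c1_const_pos[OF pos(5,6)] c2_const_pos[OF pos(5,6)] c1_const_le[OF pos(5,6)] pos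
    by (simp_all add: c\<^sub>1_def c\<^sub>2_def)
  have nonneg: "0 \<le> E" "0 \<le> H" "0 \<le> X" "0 \<le> N" "0 \<le> T" "0 \<le> \<tau>"
    by (auto simp: E_def H_def X_def N_def T_def \<tau>_def)
  have iota: "0 < \<iota>"
    unfolding \<iota>_def using Gt c pos constants by (intro add_pos_nonneg) auto
  have T: "T = \<Gamma>\<^sub>t\<^sup>2 * \<tau>" using Gt by (simp add: \<tau>_def)
  \<comment> \<open>Three forms of one stepsize bound: for the curvature of \<open>psi\<close>, for
    the curvature of \<open>L\<close> in \<open>y\<close>, and for the coupling term absorbed in
    \<open>B\<close>.\<close>
  have beta_l: "\<beta> * l\<^sub>\<psi> * \<Gamma>\<^sub>t\<^sup>2 \<le> c\<^sub>1 / 3" and beta_G: "\<beta> * \<Gamma>\<^sub>t\<^sup>2 \<le> c\<^sub>1 / (3 * l\<^sub>\<psi>)"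
    and beta_b: "3 * \<beta> \<le> c\<^sub>1 / (l\<^sub>\<psi> * \<Gamma>\<^sub>t\<^sup>2)"
    using beta Gt pos by (simp_all add: field_simps)

  have "\<tau> \<le> (norm g)\<^sup>2"
    using direction_bounds(1)[OF pos(5) Gt t] Gt by (simp add: \<tau>_def T_def g_def field_simps)
  also have "\<dots> \<le> 2 * H + 2 * E"
    using norm_add_power2_le[of 1 h "g - h"] by (simp add: H_def E_def norm_minus_commute)
  finally have tau: "\<tau> \<le> 2 * H + 2 * E" .

  have second_order: "l\<^sub>\<psi> / 2 * (\<beta>\<^sup>2 * T) \<le> \<beta> * (c\<^sub>1 / 6 * \<tau>)"
  proof -
    have "l\<^sub>\<psi> / 2 * (\<beta>\<^sup>2 * T) = \<beta> * ((\<beta> * l\<^sub>\<psi> * \<Gamma>\<^sub>t\<^sup>2) * (\<tau> / 2))"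
      by (simp add: T power2_eq_square)
    also have "\<dots> \<le> \<beta> * ((c\<^sub>1 / 3) * (\<tau> / 2))"
      using beta_l pos nonneg by (intro mult_left_mono mult_right_mono) auto
    finally show ?thesis by simp
  qed
  have P_lower: "P \<ge> \<beta> * (t \<bullet> h) - \<beta> * (c\<^sub>1 / 6 * \<tau>)"
    using lipschitz_gradient_lower[OF GDERIV_psi psi_gradient_lipschitz[folded l\<^sub>\<psi>_def], of y y']
      second_order
    by (simp add: P_def y'_def h_def T_def power_mult_distrib)

  \<comment> \<open>By \<open>\<tau> \<le> 2 * H + 2 * E\<close> the second-order term costs
    \<open>c\<^sub>1 / 3\<close> in the coefficients of both \<open>H\<close> and
    \<open>E\<close>.\<close>
  have P_lower': "P \<ge> \<beta> * (2 * c\<^sub>1 / 3 * H - (c\<^sub>2 + c\<^sub>1 / 3) * E)"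
  proof -
    have "t \<bullet> h \<ge> c\<^sub>1 * H - c\<^sub>2 * E"
      using direction_inner_lower[OF pos(5,6) t] by (simp add: c\<^sub>1_def c\<^sub>2_def H_def E_def g_def)
    moreover have "c\<^sub>1 / 6 * \<tau> \<le> c\<^sub>1 / 6 * (2 * H + 2 * E)"
      using tau c by (intro mult_left_mono) auto
    ultimately have "\<beta> * (2 * c\<^sub>1 / 3 * H - (c\<^sub>2 + c\<^sub>1 / 3) * E) \<le> \<beta> * (t \<bullet> h - c\<^sub>1 / 6 * \<tau>)"
      using pos by (intro mult_left_mono) (auto simp: algebra_simps)
    then show ?thesis using P_lower by (simp add: algebra_simps)
  qed

  \<comment> \<open>The summands of \<iota> have separate origins:
    \<open>\<Gamma>\<^sub>t\<^sup>2\<close> comes from \<open>T / 2\<close> in \<open>cross\<close>,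
    the last one from \<open>yy\<close>, and \<open>2 * \<Gamma>\<^sub>t\<close> covers the
    \<open>3 / 2 * \<Gamma>\<^sub>t * E\<close> left by \<open>te\<close>.\<close>
  have A_P: "A - 2 * P \<le> \<beta> * \<iota> * (H + E) + \<beta> * \<alpha>\<^sup>2 * l\<^sub>y\<^sub>x\<^sup>2 / 2 * N"
  proof -
    have A: "A \<le> \<beta> * (t \<bullet> grad_y L u' y) + l\<^sub>y\<^sub>y / 2 * (\<beta>\<^sup>2 * T)"
      using L_y_step(1)[of u' y' y] by (simp add: A_def y'_def T_def power_mult_distrib)
    have yy: "l\<^sub>y\<^sub>y / 2 * (\<beta>\<^sup>2 * T) \<le> \<beta> * (c\<^sub>1 * l\<^sub>y\<^sub>y / (3 * l\<^sub>\<psi>) * (\<tau> / 2))"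
    proof -
      have "l\<^sub>y\<^sub>y / 2 * (\<beta>\<^sup>2 * T) = \<beta> * ((\<beta> * \<Gamma>\<^sub>t\<^sup>2) * (l\<^sub>y\<^sub>y * (\<tau> / 2)))"
        by (simp add: T power2_eq_square)
      also have "\<dots> \<le> \<beta> * ((c\<^sub>1 / (3 * l\<^sub>\<psi>)) * (l\<^sub>y\<^sub>y * (\<tau> / 2)))"
        using beta_G pos nonneg constants by (intro mult_left_mono mult_right_mono) auto
      finally show ?thesis by simp
    qed
    \<comment> \<open>The \<open>y\<close> step is measured at the new point \<open>u'\<close>,
      whereas \<open>t\<close> is tied to the gradient at \<open>u\<close>. The discrepancy is of
      size \<open>l\<^sub>y\<^sub>x * \<alpha> * norm s\<close>, and its part with \<open>N\<close>
      is passed on to \<open>B\<close>.\<close>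
    have cross: "t \<bullet> grad_y L u' y \<le> t \<bullet> g + T / 2 + \<alpha>\<^sup>2 * l\<^sub>y\<^sub>x\<^sup>2 / 2 * N"
    proof -
      have "norm (grad_y L u' y - g) \<le> l\<^sub>y\<^sub>x * (\<alpha> * norm s)"
        using lipschitz_onD[OF lipschitz(3), of u' u y] pos by (simp add: g_def u'_def dist_norm)
      then have "norm t * norm (grad_y L u' y - g) \<le> norm t * (l\<^sub>y\<^sub>x * (\<alpha> * norm s))"
        by (intro mult_left_mono) auto
      then have "t \<bullet> (grad_y L u' y - g) \<le> norm t * (l\<^sub>y\<^sub>x * (\<alpha> * norm s))"
        using norm_cauchy_schwarz[of t "grad_y L u' y - g"] by simp
      also have "\<dots> \<le> T / 2 + \<alpha>\<^sup>2 * l\<^sub>y\<^sub>x\<^sup>2 / 2 * N"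
        using sum_squares_bound[of "norm t" "l\<^sub>y\<^sub>x * (\<alpha> * norm s)"]
        by (simp add: T_def N_def power_mult_distrib mult_ac)
      finally show ?thesis by (simp add: inner_diff_right)
    qed
    have tg: "t \<bullet> g \<ge> \<Gamma>\<^sub>t * \<tau>"
      using t(2) Gt by (simp add: g_def \<tau>_def T_def power2_eq_square)
    \<comment> \<open>The weights are tuned so that the multiples of
      \<open>\<Gamma>\<^sub>t * \<tau>\<close> cancel: \<open>- 1\<close> from \<open>tg\<close>,
      \<open>2 / 3\<close> from here and \<open>1 / 3\<close> from \<open>c1_tau\<close>.\<close>
    have te: "- 2 * (t \<bullet> (h - g)) \<le> 2 / 3 * \<Gamma>\<^sub>t * \<tau> + 3 / 2 * \<Gamma>\<^sub>t * E"
    proof -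
      have "0 \<le> (norm (2 *\<^sub>R t + (3 * \<Gamma>\<^sub>t) *\<^sub>R (h - g)))\<^sup>2" by simp
      also have "\<dots> = 4 * T + 12 * \<Gamma>\<^sub>t * (t \<bullet> (h - g)) + 9 * \<Gamma>\<^sub>t\<^sup>2 * E"
        unfolding T_def E_def power2_norm_eq_inner
          inner_add_left inner_add_right inner_scaleR_left inner_scaleR_right
        by (simp add: inner_commute power2_eq_square distrib_left mult.assoc)
      also have "\<dots> = 6 * \<Gamma>\<^sub>t * (2 / 3 * \<Gamma>\<^sub>t * \<tau> + 3 / 2 * \<Gamma>\<^sub>t * E + 2 * (t \<bullet> (h - g)))"
        by (simp add: T algebra_simps power2_eq_square)
      finally show ?thesis using Gt by (simp add: zero_le_mult_iff)
    qed
    have c1_tau: "c\<^sub>1 / 3 * \<tau> \<le> \<Gamma>\<^sub>t / 3 * \<tau>"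
      using c Gt nonneg by (intro mult_right_mono) auto
    let ?k = "\<Gamma>\<^sub>t\<^sup>2 + c\<^sub>1 * l\<^sub>y\<^sub>y / (3 * l\<^sub>\<psi>)"
    have "?k * (\<tau> / 2) \<le> ?k * (H + E)"
      using tau c pos constants by (intro mult_left_mono add_nonneg_nonneg) auto
    moreover have "0 \<le> \<Gamma>\<^sub>t * H" "0 \<le> \<Gamma>\<^sub>t * E" using Gt nonneg by auto
    ultimately have "t \<bullet> grad_y L u' y + c\<^sub>1 * l\<^sub>y\<^sub>y / (3 * l\<^sub>\<psi>) * (\<tau> / 2) - 2 * (t \<bullet> h - c\<^sub>1 / 6 * \<tau>)
        \<le> \<iota> * (H + E) + \<alpha>\<^sup>2 * l\<^sub>y\<^sub>x\<^sup>2 / 2 * N"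
      using cross tg te c1_tau T unfolding \<iota>_def inner_diff_right by (simp add: algebra_simps)
    from mult_left_mono[OF this, of \<beta>] show ?thesis
      using A yy P_lower pos by (simp add: algebra_simps)
  qed

  \<comment> \<open>The first-order gain is \<open>\<alpha> * \<gamma>\<^sub>s * X\<close>. The
    bound on \<alpha> limits the curvature term and the coupling term left by \<open>A_P\<close>
    together to a third of it.\<close>
  have B: "B + \<beta> * \<alpha>\<^sup>2 * l\<^sub>y\<^sub>x\<^sup>2 / 2 * N \<le> - (2 / 3 * \<alpha> * \<gamma>\<^sub>s * X)"
  proof -
    note sb = direction_bounds[OF pos(3,4) s]
    let ?m = "3 * l\<^sub>x\<^sub>x + c\<^sub>1 * l\<^sub>y\<^sub>x\<^sup>2 / (l\<^sub>\<psi> * \<Gamma>\<^sub>t\<^sup>2)"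
    have m: "0 < ?m"
      using constants c pos by (intro add_pos_nonneg) auto
    have am: "\<alpha> * \<Gamma>\<^sub>s\<^sup>2 * ?m \<le> 2 * \<gamma>\<^sub>s"
    proof -
      have "0 < \<Gamma>\<^sub>s\<^sup>2 * ?m" using m pos by simp
      with alpha show ?thesis by (simp only: pos_le_divide_eq mult.assoc)
    qed
    have "3 * \<beta> * l\<^sub>y\<^sub>x\<^sup>2 \<le> c\<^sub>1 / (l\<^sub>\<psi> * \<Gamma>\<^sub>t\<^sup>2) * l\<^sub>y\<^sub>x\<^sup>2"
      using beta_b by (intro mult_right_mono) auto
    then have "l\<^sub>x\<^sub>x / 2 + \<beta> * l\<^sub>y\<^sub>x\<^sup>2 / 2 \<le> ?m / 6" by simp
    then have "\<alpha>\<^sup>2 * N * (l\<^sub>x\<^sub>x / 2 + \<beta> * l\<^sub>y\<^sub>x\<^sup>2 / 2) \<le> \<alpha>\<^sup>2 * N * (?m / 6)"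
      using nonneg by (intro mult_left_mono) auto
    also have "\<dots> \<le> \<alpha>\<^sup>2 * (\<Gamma>\<^sub>s\<^sup>2 * X) * (?m / 6)"
      using sb m by (intro mult_left_mono mult_right_mono) (auto simp: N_def X_def)
    also have "\<dots> = \<alpha> * X / 6 * (\<alpha> * \<Gamma>\<^sub>s\<^sup>2 * ?m)" by (simp only: power2_eq_square) simp
    also have "\<dots> \<le> \<alpha> * X / 6 * (2 * \<gamma>\<^sub>s)"
      using am pos nonneg by (intro mult_left_mono) auto
    finally have quad: "\<alpha>\<^sup>2 * N * (l\<^sub>x\<^sub>x / 2 + \<beta> * l\<^sub>y\<^sub>x\<^sup>2 / 2) \<le> \<alpha> * \<gamma>\<^sub>s * X / 3" by (simp add: mult_ac)
    have "B \<le> - (\<alpha> * (s \<bullet> grad_x L u y)) + l\<^sub>x\<^sub>x / 2 * (\<alpha>\<^sup>2 * N)"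
      using L_x_step[of u' y u] by (simp add: B_def u'_def N_def power_mult_distrib)
    moreover have "\<alpha> * (s \<bullet> grad_x L u y) \<ge> \<alpha> * (\<gamma>\<^sub>s * X)"
      using sb pos by (intro mult_left_mono) (auto simp: X_def)
    ultimately show ?thesis using quad by (simp add: algebra_simps)
  qed

  \<comment> \<open>Here the second bound on \<beta> enters, charging the gradient error to another
    third of the gain in \<open>x\<close>. If \<open>l\<^sub>y\<^sub>x = 0\<close>, the error
    \<open>E\<close> vanishes.\<close>
  have E_X: "\<beta> * (\<iota> * (3 * c\<^sub>2 / c\<^sub>1 + 2)) * E \<le> \<alpha> * \<gamma>\<^sub>s / 3 * X"
  proof -
    have "(m\<^sub>x * norm (h - g))\<^sup>2 \<le> (l\<^sub>y\<^sub>x * norm (grad_x L u y))\<^sup>2"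
      using grad_y_error[of y u] constants by (intro power_mono) (auto simp: g_def h_def)
    then have err: "m\<^sub>x\<^sup>2 * E \<le> l\<^sub>y\<^sub>x\<^sup>2 * X"
      by (simp add: E_def X_def power_mult_distrib)
    show ?thesis
    proof (cases "l\<^sub>y\<^sub>x = 0")
      case True
      then have "E = 0" using err constants nonneg by (simp add: mult_le_0_iff)
      then show ?thesis using pos nonneg by simp
    next
      case False
      let ?w = "\<iota> * (3 * c\<^sub>2 + 2 * c\<^sub>1)"
      have d: "0 < 3 * l\<^sub>y\<^sub>x\<^sup>2 * \<iota> * (3 * c\<^sub>2 + 2 * c\<^sub>1)" using iota c False by simp
      have "\<beta> * (3 * l\<^sub>y\<^sub>x\<^sup>2 * \<iota> * (3 * c\<^sub>2 + 2 * c\<^sub>1)) \<le> \<alpha> * \<gamma>\<^sub>s * m\<^sub>x\<^sup>2 * c\<^sub>1"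
        using beta'[OF False] by (simp only: pos_le_divide_eq[OF d])
      then have "\<beta> * (3 * l\<^sub>y\<^sub>x\<^sup>2 * \<iota> * (3 * c\<^sub>2 + 2 * c\<^sub>1)) * E \<le> \<alpha> * \<gamma>\<^sub>s * m\<^sub>x\<^sup>2 * c\<^sub>1 * E"
        using nonneg by (intro mult_right_mono)
      also have "\<dots> = \<alpha> * \<gamma>\<^sub>s * c\<^sub>1 * (m\<^sub>x\<^sup>2 * E)" by simp
      also have "\<dots> \<le> \<alpha> * \<gamma>\<^sub>s * c\<^sub>1 * (l\<^sub>y\<^sub>x\<^sup>2 * X)"
        using err pos c by (intro mult_left_mono) auto
      finally have "l\<^sub>y\<^sub>x\<^sup>2 * (3 * \<beta> * ?w * E) \<le> l\<^sub>y\<^sub>x\<^sup>2 * (\<alpha> * \<gamma>\<^sub>s * c\<^sub>1 * X)"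
        by (simp only: mult_ac)
      then have le: "3 * \<beta> * ?w * E \<le> \<alpha> * \<gamma>\<^sub>s * c\<^sub>1 * X"
        by (rule mult_left_le_imp_le) (use False in simp)
      have "\<iota> * (3 * c\<^sub>2 / c\<^sub>1 + 2) = ?w / c\<^sub>1" using c by (simp add: field_simps)
      then have "\<beta> * (\<iota> * (3 * c\<^sub>2 / c\<^sub>1 + 2)) * E = 3 * \<beta> * ?w * E / (3 * c\<^sub>1)" by simp
      also have "\<dots> \<le> \<alpha> * \<gamma>\<^sub>s * c\<^sub>1 * X / (3 * c\<^sub>1)"
        using le c by (intro divide_right_mono) auto
      also have "\<dots> = \<alpha> * \<gamma>\<^sub>s / 3 * X" using c by simp
      finally show ?thesis .
    qed
  qed

  \<comment> \<open>The weight \<open>3 * \<iota> / c\<^sub>1\<close> turns the coefficient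
    \<open>2 * c\<^sub>1 / 3\<close> of \<open>H\<close> into \<open>2 * \<iota>\<close>, twice what
    \<open>A_P\<close> consumes. The coefficient of \<open>E\<close> is split so that
    \<open>\<beta> * \<iota> * E\<close> cancels the error in \<open>A_P\<close> and the rest
    matches \<open>E_X\<close>.\<close>
  have "3 * \<iota> / c\<^sub>1 * P \<ge> 3 * \<iota> / c\<^sub>1 * (\<beta> * (2 * c\<^sub>1 / 3 * H - (c\<^sub>2 + c\<^sub>1 / 3) * E))"
    using P_lower' iota c by (intro mult_left_mono) auto
  also have "3 * \<iota> / c\<^sub>1 * (\<beta> * (2 * c\<^sub>1 / 3 * H - (c\<^sub>2 + c\<^sub>1 / 3) * E))
      = 2 * \<beta> * \<iota> * H - \<beta> * (\<iota> * (3 * c\<^sub>2 / c\<^sub>1 + 2)) * E + \<beta> * \<iota> * E"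
  proof -
    define r where "r = \<iota> / c\<^sub>1"
    have "3 * \<iota> / c\<^sub>1 = 3 * r" "\<iota> * (3 * c\<^sub>2 / c\<^sub>1 + 2) = r * (3 * c\<^sub>2 + 2 * c\<^sub>1)" "\<iota> = r * c\<^sub>1"
      using c by (simp_all add: r_def distrib_left)
    then show ?thesis by (simp only:) (simp add: algebra_simps)
  qed
  finally have P_weighted: "2 * \<beta> * \<iota> * H - \<beta> * (\<iota> * (3 * c\<^sub>2 / c\<^sub>1 + 2)) * E + \<beta> * \<iota> * E
      \<le> 3 * \<iota> / c\<^sub>1 * P" .
  have "- (3 * \<iota> / c\<^sub>1 * P) + (A - 2 * P) + B \<le> - (\<beta> * \<iota> * H) - \<alpha> * \<gamma>\<^sub>s / 3 * X"
  proof -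
    define Q V where "Q = 3 * \<iota> / c\<^sub>1 * P" and "V = \<beta> * (\<iota> * (3 * c\<^sub>2 / c\<^sub>1 + 2)) * E"
    show ?thesis
      using P_weighted A_P B E_X unfolding Q_def[symmetric] V_def[symmetric]
      by (simp add: algebra_simps)
  qed
  moreover have "Delta L ystar \<iota> c\<^sub>1 u' y' - Delta L ystar \<iota> c\<^sub>1 u y
      = - (3 * \<iota> / c\<^sub>1 * P) + (A - 2 * P) + B"
    unfolding Delta_def Delta_y_def Delta_x_def P_def A_def B_def psi_def[symmetric]
    by (simp add: algebra_simps diff_divide_distrib)
  ultimately show ?thesis
    by (simp add: H_def X_def h_def u'_def y'_def)
qed

end

section \<open>Contraction of \<open>Delta\<close> along the iterates\<close>

theorem theorem4p15:
  fixes L :: "(real ^ 'd) \<times> (real ^ 'p) \<Rightarrow> real"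
    and m\<^sub>x l\<^sub>x\<^sub>x l\<^sub>x\<^sub>y l\<^sub>y\<^sub>x l\<^sub>y\<^sub>y p\<^sub>\<psi> \<alpha> \<beta> \<gamma>\<^sub>s \<Gamma>\<^sub>s \<gamma>\<^sub>t \<Gamma>\<^sub>t c\<^sub>1 c\<^sub>2 l\<^sub>\<psi> \<iota> \<delta> :: real
    and ystar :: "real ^ 'p"
    and K :: nat
    and x s :: "nat \<Rightarrow> real ^ 'd"
    and y t :: "nat \<Rightarrow> real ^ 'p"
  assumes R: "regular L m\<^sub>x l\<^sub>x\<^sub>x l\<^sub>x\<^sub>y l\<^sub>y\<^sub>x l\<^sub>y\<^sub>y"
    and PL: "PL_cond L p\<^sub>\<psi> ystar"
    and K: "K \<ge> 1"
    and steps: "\<alpha> > 0" "\<beta> > 0"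
    and iterates: "GRAND_iterates \<alpha> \<beta> K x y s t"
    and D: "direction_cond L \<gamma>\<^sub>s \<Gamma>\<^sub>s \<gamma>\<^sub>t \<Gamma>\<^sub>t K x y s t"
    and gammas: "\<gamma>\<^sub>s \<le> \<Gamma>\<^sub>s" "\<gamma>\<^sub>t \<le> \<Gamma>\<^sub>t"
    and c1: "c\<^sub>1 = c1_const \<gamma>\<^sub>t \<Gamma>\<^sub>t"
    and c2: "c\<^sub>2 = c2_const \<gamma>\<^sub>t \<Gamma>\<^sub>t"
    and l_psi: "l\<^sub>\<psi> = l\<^sub>y\<^sub>y + l\<^sub>y\<^sub>x * l\<^sub>x\<^sub>y / m\<^sub>x" "l\<^sub>\<psi> > 0"
    and iota: "\<iota> = 2 * \<Gamma>\<^sub>t + \<Gamma>\<^sub>t\<^sup>2 + c\<^sub>1 * l\<^sub>y\<^sub>y / (3 * l\<^sub>\<psi>)"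
    and alpha: "\<alpha> \<le> 2 * \<gamma>\<^sub>s / (\<Gamma>\<^sub>s\<^sup>2 * (3 * l\<^sub>x\<^sub>x + c\<^sub>1 * l\<^sub>y\<^sub>x\<^sup>2 / (l\<^sub>\<psi> * \<Gamma>\<^sub>t\<^sup>2)))"
    and beta1: "\<beta> \<le> (if l\<^sub>y\<^sub>x = 0 then c\<^sub>1 / (3 * l\<^sub>\<psi> * \<Gamma>\<^sub>t\<^sup>2)
                     else min (c\<^sub>1 / (3 * l\<^sub>\<psi> * \<Gamma>\<^sub>t\<^sup>2))
                              (\<alpha> * \<gamma>\<^sub>s * m\<^sub>x\<^sup>2 * c\<^sub>1 / (3 * l\<^sub>y\<^sub>x\<^sup>2 * \<iota> * (3 * c\<^sub>2 + 2 * c\<^sub>1))))"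
    and beta2: "\<beta> < (3 * \<iota> + c\<^sub>1) / (2 * \<iota> * p\<^sub>\<psi> * c\<^sub>1)"
    and delta: "\<delta> = min (2 * \<beta> * \<iota> * p\<^sub>\<psi> * c\<^sub>1 / (3 * \<iota> + c\<^sub>1)) (2 * \<alpha> * \<gamma>\<^sub>s * m\<^sub>x / 3)"
  shows "0 < \<delta> \<and> \<delta> < 1 \<and>
    (\<forall>k<K. Delta L ystar \<iota> c\<^sub>1 (x (Suc k)) (y (Suc k)) \<le> (1 - \<delta>) * Delta L ystar \<iota> c\<^sub>1 (x k) (y k))"
proof -
  interpret regular_minimax L m\<^sub>x l\<^sub>x\<^sub>x l\<^sub>x\<^sub>y l\<^sub>y\<^sub>x l\<^sub>y\<^sub>y
    using R by unfold_locales
  have G: "0 < \<gamma>\<^sub>s" "0 < \<Gamma>\<^sub>s" "0 < \<gamma>\<^sub>t" "0 < \<Gamma>\<^sub>t"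
    using D by (auto simp: direction_cond_def)
  have p: "0 < p\<^sub>\<psi>" and psi_le: "psi L v \<le> psi L ystar"
    and psi_PL: "1 / 2 * (norm (grad (psi L) v))\<^sup>2 \<ge> p\<^sub>\<psi> * (psi L ystar - psi L v)" for v
    using PL by (auto simp: PL_cond_def)
  have c1_pos: "0 < c\<^sub>1" using c1_const_pos G gammas by (simp add: c1)
  have iota_pos: "0 < \<iota>"
    unfolding iota using G c1_pos l_psi(2) constants by (intro add_pos_nonneg) auto
  have "0 < \<delta>"
    using steps iota_pos p c1_pos G constants by (simp add: delta)
  \<comment> \<open>It suffices that the first entry of the minimum is below 1, which is the strict
    bound on \<beta>.\<close>
  moreover have "\<delta> < 1"
  proof -
    have "2 * \<beta> * \<iota> * p\<^sub>\<psi> * c\<^sub>1 / (3 * \<iota> + c\<^sub>1) < 1"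
      using beta2 iota_pos p c1_pos by (simp add: field_simps)
    then show ?thesis by (simp add: delta)
  qed
  moreover have "Delta L ystar \<iota> c\<^sub>1 (x (Suc k)) (y (Suc k))
      \<le> (1 - \<delta>) * Delta L ystar \<iota> c\<^sub>1 (x k) (y k)" if "k < K" for k
  proof -
    let ?h = "grad_y L (xstar L (y k)) (y k)" and ?g = "grad_x L (x k) (y k)"
    have "Delta L ystar \<iota> c\<^sub>1 (x (Suc k)) (y (Suc k)) \<le> Delta L ystar \<iota> c\<^sub>1 (x k) (y k)
        - \<beta> * \<iota> * (norm ?h)\<^sup>2 - \<alpha> * \<gamma>\<^sub>s / 3 * (norm ?g)\<^sup>2"
    proof -
      have "x (Suc k) = x k - \<alpha> *\<^sub>R s k" "y (Suc k) = y k + \<beta> *\<^sub>R t k"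
        using iterates that by (auto simp: GRAND_iterates_def)
      moreover have "Delta L ystar \<iota> c\<^sub>1 (x k - \<alpha> *\<^sub>R s k) (y k + \<beta> *\<^sub>R t k)
          \<le> Delta L ystar \<iota> c\<^sub>1 (x k) (y k)
            - \<beta> * \<iota> * (norm ?h)\<^sup>2 - \<alpha> * \<gamma>\<^sub>s / 3 * (norm ?g)\<^sup>2"
        unfolding iota c1 l_psi(1)
        by (rule Delta_step)
          (use steps G gammas l_psi D that alpha beta1 in
            \<open>auto simp: direction_cond_def iota c1 c2 split: if_splits\<close>)
      ultimately show ?thesis by simp
    qed
    \<comment> \<open>The PL inequality applies to \<open>?h\<close> because it is the gradient of
      \<open>psi\<close>. The first entry of the minimum is the rate at which the weight of
      \<open>Delta_y\<close> cancels exactly.\<close>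
    moreover have "\<beta> * \<iota> * (norm ?h)\<^sup>2 \<ge> \<delta> * ((3 * \<iota> / c\<^sub>1 + 1) * Delta_y L ystar (y k))"
    proof -
      have Dy: "0 \<le> Delta_y L ystar (y k)" using psi_le by (simp add: Delta_y_def)
      have "grad (psi L) (y k) = ?h" by (rule grad_eqI[OF GDERIV_psi])
      then have H: "2 * p\<^sub>\<psi> * Delta_y L ystar (y k) \<le> (norm ?h)\<^sup>2"
        using psi_PL[of "y k"] by (simp add: Delta_y_def)
      have "\<delta> * ((3 * \<iota> / c\<^sub>1 + 1) * Delta_y L ystar (y k))
          \<le> 2 * \<beta> * \<iota> * p\<^sub>\<psi> * c\<^sub>1 / (3 * \<iota> + c\<^sub>1) * ((3 * \<iota> / c\<^sub>1 + 1) * Delta_y L ystar (y k))"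
        using Dy iota_pos c1_pos by (intro mult_right_mono) (auto simp: delta)
      also have "\<dots> = \<beta> * \<iota> * (2 * p\<^sub>\<psi> * Delta_y L ystar (y k))"
      proof -
        have "3 * \<iota> / c\<^sub>1 + 1 = (3 * \<iota> + c\<^sub>1) / c\<^sub>1" using c1_pos by (simp add: field_simps)
        moreover have "3 * \<iota> + c\<^sub>1 \<noteq> 0" using iota_pos c1_pos by simp
        ultimately show ?thesis using c1_pos by simp
      qed
      also have "\<dots> \<le> \<beta> * \<iota> * (norm ?h)\<^sup>2"
        using H steps iota_pos by (intro mult_left_mono) auto
      finally show ?thesis .
    qed
    \<comment> \<open>Strong convexity in \<open>x\<close> plays the part of the PL inequality here,
      with the second entry of the minimum as rate.\<close>
    moreover have "\<alpha> * \<gamma>\<^sub>s / 3 * (norm ?g)\<^sup>2 \<ge> \<delta> * Delta_x L (x k) (y k)"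
    proof -
      have "0 \<le> Delta_x L (x k) (y k)" using xstar_le by (simp add: Delta_x_def)
      then have "\<delta> * Delta_x L (x k) (y k) \<le> 2 * \<alpha> * \<gamma>\<^sub>s * m\<^sub>x / 3 * Delta_x L (x k) (y k)"
        by (intro mult_right_mono) (auto simp: delta)
      also have "\<dots> = \<alpha> * \<gamma>\<^sub>s / 3 * (2 * m\<^sub>x * Delta_x L (x k) (y k))" by simp
      also have "\<dots> \<le> \<alpha> * \<gamma>\<^sub>s / 3 * (norm ?g)\<^sup>2"
        using strongly_convex_PL[OF strongly_convex constants(1) GDERIV_x] steps G
        by (intro mult_left_mono) (auto simp: Delta_x_def)
      finally show ?thesis .
    qed
    ultimately have "Delta L ystar \<iota> c\<^sub>1 (x (Suc k)) (y (Suc k)) \<le> Delta L ystar \<iota> c\<^sub>1 (x k) (y k)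
        - \<delta> * ((3 * \<iota> / c\<^sub>1 + 1) * Delta_y L ystar (y k)) - \<delta> * Delta_x L (x k) (y k)"
      by linarith
    also have "\<dots> = (1 - \<delta>) * Delta L ystar \<iota> c\<^sub>1 (x k) (y k)"
      unfolding Delta_def left_diff_distrib distrib_left by simp
    finally show ?thesis .
  qed
  ultimately show ?thesis by blast
qed

end
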